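(* Let $D\subseteq[n]^2$ and $\alpha=(\alpha_1,\dots,\alpha_n)\in\mathbb{Z}_{\ge 0}^n$ with $\alpha_1+\dots+\alpha_n=\#D$. Then $\alpha\in\mathcal{S}_D$ (the Schubitope of $D$) if and only if for each $S\subseteq[n]$, $$\sum_{i\in S}\alpha_i\le\#\pi_{D,S}^{-1}(S).$$
   Context: Fix $n\in\mathbb{Z}_{>0}$. A diagram is a subset $D\subseteq[n]^2$, where $(r,c)$ is the box in the $r$th row from the top and $c$th column from the left of an $n\times n$ grid. Given $S\subseteq[n]$ and a column $c\in[n]$, the string $\mathsf{word}_{c,S}(D)$ is obtained by reading column $c$ from top to bottom ($r=1,\dots,n$) and recording: "$($" if $(r,c)\notin D$ and $r\in S$; "$)$" if $(r,c)\in D$ and $r\notin S$; "$\star$" if $(r,c)\in D$ and $r\in S$; nothing otherwise. Parentheses are paired by the standard inside-out matching (ignoring $\star$'s). Let $\theta_D^c(S)$ be the number of $\star$'s in $\mathsf{word}_{c,S}(D)$ plus the number of matched pairs $()$ in $\mathsf{word}_{c,S}(D)$, and let $\theta_D(S)=\sum_{c=1}^n\theta_D^c(S)$. The Schubitope is $$\mathcal{S}_D=\Big\{(\alpha_1,\dots,\alpha_n)\in\mathbb{R}_{\ge0}^n:\ \alpha_1+\dots+\alpha_n=\#D\ \text{ and }\ \sum_{i\in S}\alpha_i\le\theta_D(S)\text{ for all }S\subseteq[n]\Big\}.$$ For $S\subseteq[n]$, the tableau $\pi_{D,S}:D\to[n]\cup\{\circ\}$ (where $\circ$ means "unlabelled")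 is defined by: $\pi_{D,S}(r,c)=r$ if $(r,c)$ contributes a "$\star$" to $\mathsf{word}_{c,S}(D)$; $\pi_{D,S}(r,c)=s$ if $(r,c)$ contributes a "$)$" to $\mathsf{word}_{c,S}(D)$ that is paired with a "$($" coming from $(s,c)$; and $\pi_{D,S}(r,c)=\circ$ otherwise. *)

theory Defs
  imports Complex_Main "HOL-Library.FuncSet"
begin

text \<open>Indices are 1-based: \<open>[n]\<close> is \<open>{1..n}\<close>, and a diagram is a set
  \<open>D \<subseteq> {1..n} \<times> {1..n}\<close> of boxes (row, column).\<close>

datatype symbol = LParen | RParen | Star

definition box_symbol :: "(nat \<times> nat) set \<Rightarrow> nat \<Rightarrow> nat set \<Rightarrow> nat \<Rightarrow> symbol option" where
  "box_symbol D c S r =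
     (if (r, c) \<notin> D \<and> r \<in> S then Some LParen
      else if (r, c) \<in> D \<and> r \<notin> S then Some RParen
      else if (r, c) \<in> D \<and> r \<in> S then Some Star
      else None)"

text \<open>Each letter of the word is stored together with the row it comes from; the string
  itself is \<open>map snd (column_word n D c S)\<close>.\<close>

definition column_word :: "nat \<Rightarrow> (nat \<times> nat) set \<Rightarrow> nat \<Rightarrow> nat set \<Rightarrow> (nat \<times> symbol) list" where
  "column_word n D c S =
     List.map_filter (\<lambda>r. map_option (Pair r) (box_symbol D c S r)) [1..<Suc n]"

text \<open>Inside-out matching of the letters at (0-based) positions \<open>i < j\<close>: they are paired once
  every parenthesis strictly between them has been paired with another one strictly between
  them, stars being ignored.\<close>

inductive paired :: "symbol list \<Rightarrow> nat \<Rightarrow> nat \<Rightarrow> bool" for w where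
  "\<lbrakk>i < j; j < length w; w ! i = LParen; w ! j = RParen;
    \<forall>k. i < k \<and> k < j \<and> w ! k \<noteq> Star \<longrightarrow>
      (\<exists>l. i < l \<and> l < j \<and> (paired w k l \<or> paired w l k))\<rbrakk>
   \<Longrightarrow> paired w i j"

text \<open>The partner of a parenthesis is unique, so the definite description in
  \<open>tableau\<close> below is well-defined.\<close>

lemma paired_symbols:
  "paired w i j \<Longrightarrow> i < j \<and> j < length w \<and> w ! i = LParen \<and> w ! j = RParen"
  by (auto elim: paired.cases)

lemma paired_unique:
  "paired w i j \<Longrightarrow> (\<forall>j'. paired w i j' \<longrightarrow> j' = j) \<and> (\<forall>i'. paired w i' j \<longrightarrow> i' = i)"
proof (induction rule: paired.induct)
  case (1 i j)
  have inner: "\<exists>l. i < l \<and> l < j \<and>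
      (paired w k l \<and> (\<forall>j'. paired w k j' \<longrightarrow> j' = l) \<or>
       paired w l k \<and> (\<forall>i'. paired w i' k \<longrightarrow> i' = l))"
    if "i < k" "k < j" "w ! k \<noteq> Star" for k
    using 1(5) that by blast
  have right: "j' = j" if p: "paired w i j'" for j'
  proof (rule linorder_cases[of j' j])
    assume "j' < j"
    have sym: "i < j'" "w ! j' = RParen" using paired_symbols[OF p] by simp_all
    then obtain l where l: "i < l" "paired w j' l \<or> (\<forall>i'. paired w i' j' \<longrightarrow> i' = l)"
      using inner[of j'] \<open>j' < j\<close> by auto
    have "\<not> paired w j' l" using paired_symbols[of w j' l] sym by auto
    then have "i = l" using l(2) p by blast
    then show ?thesis using l(1) by simp
  next
    assume "j < j'"
    have "\<exists>l. i < l \<and> (paired w j l \<or> paired w l j)"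
      using p
    proof cases
      case 1
      then show ?thesis using \<open>j < j'\<close> \<open>i < j\<close> \<open>w ! j = RParen\<close> by auto
    qed
    moreover have "\<not> paired w j l" for l
      using paired_symbols[of w j l] \<open>w ! j = RParen\<close> by auto
    ultimately obtain l where l: "i < l" "paired w l j" by blast
    have sym: "l < j" "w ! l = LParen" using paired_symbols[OF l(2)] by simp_all
    then obtain m where m: "m < j" "paired w m l \<or> (\<forall>j'. paired w l j' \<longrightarrow> j' = m)"
      using inner[of l] l(1) by auto
    have "\<not> paired w m l" using paired_symbols[of w m l] sym by auto
    then have "j = m" using m(2) l(2) by blast
    then show ?thesis using m(1) by simp
  qed simp
  have left: "i' = i" if p: "paired w i' j" for i'
  proof (rule linorder_cases[of i' i])
    assume "i < i'"
    have sym: "i' < j" "w ! i' = LParen" using paired_symbols[OF p] by simp_all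
    then obtain l where l: "l < j" "paired w l i' \<or> (\<forall>j'. paired w i' j' \<longrightarrow> j' = l)"
      using inner[of i'] \<open>i < i'\<close> by auto
    have "\<not> paired w l i'" using paired_symbols[of w l i'] sym by auto
    then have "j = l" using l(2) p by blast
    then show ?thesis using l(1) by simp
  next
    assume "i' < i"
    have "\<exists>l. l < j \<and> (paired w i l \<or> paired w l i)"
      using p
    proof cases
      case 1
      then show ?thesis using \<open>i' < i\<close> \<open>i < j\<close> \<open>w ! i = LParen\<close> by auto
    qed
    moreover have "\<not> paired w l i" for l
      using paired_symbols[of w l i] \<open>w ! i = LParen\<close> by auto
    ultimately obtain l where l: "l < j" "paired w i l" by blast
    have sym: "i < l" "w ! l = RParen" using paired_symbols[OF l(2)] by simp_all
    then obtain m where m: "i < m" "paired w l m \<or> (\<forall>i'. paired w i' l \<longrightarrow> i' = m)"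
      using inner[of l] l(1) by auto
    have "\<not> paired w l m" using paired_symbols[of w l m] sym by auto
    then have "i = m" using m(2) l(2) by blast
    then show ?thesis using m(1) by simp
  qed simp
  show ?case using left right by blast
qed

definition theta_column :: "nat \<Rightarrow> (nat \<times> nat) set \<Rightarrow> nat \<Rightarrow> nat set \<Rightarrow> nat" where
  "theta_column n D c S =
     (let w = map snd (column_word n D c S)
      in card {i. i < length w \<and> w ! i = Star} + card {(i, j). paired w i j})"

definition theta :: "nat \<Rightarrow> (nat \<times> nat) set \<Rightarrow> nat set \<Rightarrow> nat" where
  "theta n D S = (\<Sum>c = 1..n. theta_column n D c S)"

text \<open>Vectors in \<open>\<real>\<^sup>n\<close> are extensional functions on \<open>{1..n}\<close>.\<close>

definition schubitope :: "nat \<Rightarrow> (nat \<times> nat) set \<Rightarrow> (nat \<Rightarrow> real) set" where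
  "schubitope n D =
     {\<alpha> \<in> {1..n} \<rightarrow>\<^sub>E {0..}.
        (\<Sum>i = 1..n. \<alpha> i) = real (card D) \<and>
        (\<forall>S \<subseteq> {1..n}. (\<Sum>i\<in>S. \<alpha> i) \<le> real (theta n D S))}"

text \<open>\<open>None\<close> plays the role of the label \<open>\<circ>\<close>; values outside \<open>D\<close> are irrelevant.\<close>

definition tableau :: "nat \<Rightarrow> (nat \<times> nat) set \<Rightarrow> nat set \<Rightarrow> nat \<times> nat \<Rightarrow> nat option" where
  "tableau n D S = (\<lambda>(r, c).
     let w = column_word n D c S;
         partner = (\<lambda>s. \<exists>i j. paired (map snd w) i j \<and> w ! j = (r, RParen) \<and> w ! i = (s, LParen))
     in if (r, Star) \<in> set w then Some r
        else if \<exists>s. partner s then Some (THE s. partner s)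
        else None)"

end

theory Submission
  imports Defs
begin

text \<open>The two families of inequalities have the same right-hand sides: a box of \<open>D\<close> gets a label
  exactly when it contributes a star or a matched closing parenthesis, and every label lies in \<open>S\<close>,
  because it is the row of a star or of an opening parenthesis. Hence \<open>\<theta>\<^sub>D(S) = #\<pi>\<^sub>D\<^sub>,\<^sub>S\<^sup>-\<^sup>1(S)\<close>.\<close>

lemma set_column_word:
  "set (column_word n D c S) = {(r, x). r \<in> {1..n} \<and> box_symbol D c S r = Some x}"
  unfolding column_word_def by (force simp: map_filter_def)

text \<open>Each row emits at most one letter, so the recorded rows form a filtered sublist of
  \<open>[1..<Suc n]\<close>.\<close>

lemma distinct_rows_column_word: "distinct (map fst (column_word n D c S))"
proof -
  have "map fst (List.map_filter (\<lambda>r. map_option (Pair r) (f r)) xs)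
      = filter (\<lambda>r. f r \<noteq> None) xs" for f :: "nat \<Rightarrow> symbol option" and xs
    by (induction xs) (auto simp: map_filter_def)
  then show ?thesis
    unfolding column_word_def by simp
qed

lemma box_symbol_iff:
  "box_symbol D c S r = Some LParen \<longleftrightarrow> (r, c) \<notin> D \<and> r \<in> S"
  "box_symbol D c S r = Some RParen \<longleftrightarrow> (r, c) \<in> D \<and> r \<notin> S"
  "box_symbol D c S r = Some Star \<longleftrightarrow> (r, c) \<in> D \<and> r \<in> S"
  by (auto simp: box_symbol_def)

text \<open>Translates between the two ways of addressing a letter: \<open>paired\<close> and
  \<open>theta_column\<close> use positions in the word, \<open>tableau\<close> uses rows.\<close>

lemma column_word_row_inj:
  assumes "i < length (column_word n D c S)" "j < length (column_word n D c S)"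
    and "fst (column_word n D c S ! i) = fst (column_word n D c S ! j)"
  shows "i = j"
  using distinct_rows_column_word[of n D c S] assms
  by (metis length_map nth_eq_iff_index_eq nth_map)

lemma paired_column_word:
  assumes "paired (map snd (column_word n D c S)) i j"
  shows "\<exists>s \<in> S. column_word n D c S ! i = (s, LParen)"
    and "\<exists>r. column_word n D c S ! j = (r, RParen) \<and> r \<notin> S \<and> (r, c) \<in> D"
proof -
  let ?w = "column_word n D c S"
  have len: "i < length ?w" "j < length ?w" and snd: "snd (?w ! i) = LParen" "snd (?w ! j) = RParen"
    using paired_symbols[OF assms] by auto
  then have eq: "?w ! i = (fst (?w ! i), LParen)" "?w ! j = (fst (?w ! j), RParen)"
    by (auto simp: prod_eq_iff)
  then have "(fst (?w ! i), LParen) \<in> set ?w" "(fst (?w ! j), RParen) \<in> set ?w"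
    using nth_mem[OF len(1)] nth_mem[OF len(2)] by auto
  then have "fst (?w ! i) \<in> S" "fst (?w ! j) \<notin> S" "(fst (?w ! j), c) \<in> D"
    by (auto simp: set_column_word box_symbol_iff)
  with eq show "\<exists>s \<in> S. ?w ! i = (s, LParen)"
    and "\<exists>r. ?w ! j = (r, RParen) \<and> r \<notin> S \<and> (r, c) \<in> D"
    by blast+
qed

text \<open>No label falls outside \<open>S\<close>: a star is labelled by its own row, a closing
  parenthesis by the row of its partner, and stars and opening parentheses occur only in rows of
  \<open>S\<close>. So having a label in \<open>S\<close> just means being labelled.\<close>

lemma tableau_in_iff:
  "tableau n D S (r, c) \<in> Some ` S \<longleftrightarrow>
     (r, Star) \<in> set (column_word n D c S) \<or>
     (\<exists>i j. paired (map snd (column_word n D c S)) i j \<and> column_word n D c S ! j = (r, RParen))"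
  (is "_ \<longleftrightarrow> ?star \<or> ?closing")
proof -
  let ?w = "column_word n D c S"
  define partner where "partner s \<longleftrightarrow>
    (\<exists>i j. paired (map snd ?w) i j \<and> ?w ! j = (r, RParen) \<and> ?w ! i = (s, LParen))" for s
  \<comment> \<open>This makes the \<open>THE\<close> in \<open>tableau\<close> denote the partner:
    the row \<open>r\<close> fixes the position of the closing letter, and
    \<open>paired_unique\<close> then fixes that of the opening one.\<close>
  have unique: "s' = s" if "partner s" "partner s'" for s s'
  proof -
    from that obtain i j i' j' where
      p: "paired (map snd ?w) i j" "?w ! j = (r, RParen)" "?w ! i = (s, LParen)" and
      p': "paired (map snd ?w) i' j'" "?w ! j' = (r, RParen)" "?w ! i' = (s', LParen)"
      unfolding partner_def by blast
    have "j' = j"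
      using p p' paired_symbols[OF p(1)] paired_symbols[OF p'(1)]
      by (auto intro!: column_word_row_inj[of j' n D c S j])
    then have "i' = i"
      using paired_unique p(1) p'(1) by blast
    then show ?thesis
      using p p' by simp
  qed
  have in_S: "s \<in> S" if "partner s" for s
    using that paired_column_word(1) unfolding partner_def by fastforce
  have ex: "(\<exists>s. partner s) \<longleftrightarrow> ?closing"
    unfolding partner_def using paired_column_word(1) by blast
  have tab: "tableau n D S (r, c) =
      (if ?star then Some r else if \<exists>s. partner s then Some (THE s. partner s) else None)"
    unfolding tableau_def partner_def by (simp add: Let_def)
  show ?thesis
  proof (cases ?star)
    case True
    then show ?thesis
      by (auto simp: tab set_column_word box_symbol_iff)
  next
    case False
    have "(THE s. partner s) \<in> S" if "partner s" for s
      using that unique in_S by (metis the_equality)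
    with False show ?thesis
      by (auto simp: tab simp flip: ex)
  qed
qed

text \<open>Stars and matched pairs are counted by position; sending a star to its row and a pair to
  the row of its closing parenthesis turns both into sets of rows. These are disjoint, since the
  first lies in \<open>S\<close> and the second avoids it.\<close>

lemma theta_column_eq_card:
  "theta_column n D c S = card {r. (r, c) \<in> D \<and> tableau n D S (r, c) \<in> Some ` S}"
proof -
  define w where "w = column_word n D c S"
  define stars where "stars = {i. i < length w \<and> map snd w ! i = Star}"
  define pairs where "pairs = {(i, j). paired (map snd w) i j}"
  define star_rows where "star_rows = (\<lambda>i. fst (w ! i)) ` stars"
  define closing_rows where "closing_rows = (\<lambda>(i, j). fst (w ! j)) ` pairs"
  have "inj_on (\<lambda>i. fst (w ! i)) stars"
    unfolding inj_on_def stars_def w_def by (blast intro: column_word_row_inj)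
  then have card_star: "card star_rows = card stars"
    unfolding star_rows_def by (rule card_image)
  \<comment> \<open>The closing end is chosen because it is the box of \<open>D\<close> that carries
    the label; its row determines \<open>j\<close>, and \<open>j\<close> determines
    \<open>i\<close>.\<close>
  have "inj_on (\<lambda>(i, j). fst (w ! j)) pairs"
  proof (rule inj_onI, clarsimp simp: pairs_def)
    fix i j i' j'
    assume p: "paired (map snd w) i j" "paired (map snd w) i' j'" and eq: "fst (w ! j) = fst (w ! j')"
    have "j = j'"
      using eq paired_symbols[OF p(1)] paired_symbols[OF p(2)]
      unfolding w_def by (auto intro!: column_word_row_inj[of j n D c S j'])
    then show "i = i' \<and> j = j'"
      using paired_unique p by blast
  qed
  then have card_closing: "card closing_rows = card pairs"
    unfolding closing_rows_def by (rule card_image)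
  have star_rows: "star_rows = {r. (r, Star) \<in> set w}"
  proof -
    have "map snd w ! i = Star \<and> r = fst (w ! i) \<longleftrightarrow> w ! i = (r, Star)" if "i < length w" for i r
      using that by (auto simp: prod_eq_iff)
    then show ?thesis
      unfolding star_rows_def stars_def set_eq_iff image_iff in_set_conv_nth mem_Collect_eq by blast
  qed
  have closing_rows:
    "closing_rows = {r. \<exists>i j. paired (map snd w) i j \<and> w ! j = (r, RParen)}"
  proof -
    have "r = fst (w ! j) \<longleftrightarrow> w ! j = (r, RParen)" if "paired (map snd w) i j" for i j r
      using paired_column_word(2)[OF that[unfolded w_def]] unfolding w_def by auto
    moreover have "closing_rows = {r. \<exists>i j. paired (map snd w) i j \<and> r = fst (w ! j)}"
      unfolding closing_rows_def pairs_def by (auto simp: image_iff)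
    ultimately show ?thesis
      by blast
  qed
  have star: "r \<in> S" "(r, c) \<in> D" "r \<in> {1..n}" if "r \<in> star_rows" for r
    using that by (auto simp: star_rows w_def set_column_word box_symbol_iff)
  have closing: "r \<notin> S" "(r, c) \<in> D" "r \<in> fst ` set w" if "r \<in> closing_rows" for r
  proof -
    from that obtain i j where ij: "paired (map snd w) i j" "w ! j = (r, RParen)"
      unfolding closing_rows by blast
    show "r \<notin> S" "(r, c) \<in> D"
      using paired_column_word(2)[OF ij(1)[unfolded w_def]] ij(2) unfolding w_def by auto
    have "j < length w"
      using paired_symbols[OF ij(1)] by simp
    then show "r \<in> fst ` set w"
      using ij(2) by (metis fst_conv image_eqI nth_mem)
  qed
  have "star_rows \<subseteq> {1..n}" "closing_rows \<subseteq> fst ` set w"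
    using star(3) closing(3) by blast+
  then have fin: "finite star_rows" "finite closing_rows"
    by (auto intro: finite_subset)
  have "{r. (r, c) \<in> D \<and> tableau n D S (r, c) \<in> Some ` S} = star_rows \<union> closing_rows"
  proof -
    \<comment> \<open>Membership in \<open>D\<close> comes for free, as both kinds of letter are
      emitted only by boxes of \<open>D\<close>.\<close>
    have "tableau n D S (r, c) \<in> Some ` S \<longleftrightarrow> r \<in> star_rows \<union> closing_rows" for r
      unfolding tableau_in_iff star_rows closing_rows w_def by blast
    then show ?thesis
      using star(2) closing(2) by blast
  qed
  moreover have "star_rows \<inter> closing_rows = {}"
    using star(1) closing(1) by blast
  moreover have "theta_column n D c S = card stars + card pairs"
    unfolding theta_column_def stars_def pairs_def w_def by (simp add: Let_def)
  ultimately show ?thesis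
    using fin by (simp add: card_Un_disjoint card_star card_closing)
qed

lemma theta_eq_card_tableau:
  assumes "D \<subseteq> {1..n} \<times> {1..n}"
  shows "theta n D S = card {b \<in> D. tableau n D S b \<in> Some ` S}"
proof -
  define R where "R c = {r. (r, c) \<in> D \<and> tableau n D S (r, c) \<in> Some ` S}" for c
  have "R c \<subseteq> {1..n}" for c
    using assms unfolding R_def by auto
  then have fin: "finite (R c)" for c
    by (meson finite_subset finite_atLeastAtMost)
  \<comment> \<open>Boxes are (row, column) but the sum runs over columns, so the fibred union has
    its coordinates swapped.\<close>
  have "{b \<in> D. tableau n D S b \<in> Some ` S} = prod.swap ` Sigma {1..n} R"
    using assms unfolding R_def by force
  then have "card {b \<in> D. tableau n D S b \<in> Some ` S} = card (Sigma {1..n} R)"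
    by (simp add: card_image)
  also have "\<dots> = (\<Sum>c = 1..n. card (R c))"
    using fin by simp
  finally show ?thesis
    unfolding theta_def theta_column_eq_card R_def by simp
qed

theorem theorem3p3:
  fixes n :: nat and D :: "(nat \<times> nat) set" and \<alpha> :: "nat \<Rightarrow> real"
  assumes "n > 0"
    and "D \<subseteq> {1..n} \<times> {1..n}"
    and "\<alpha> \<in> {1..n} \<rightarrow>\<^sub>E \<nat>"
    and "(\<Sum>i = 1..n. \<alpha> i) = real (card D)"
  shows "\<alpha> \<in> schubitope n D \<longleftrightarrow>
    (\<forall>S \<subseteq> {1..n}. (\<Sum>i\<in>S. \<alpha> i) \<le> real (card {b \<in> D. tableau n D S b \<in> Some ` S}))"
proof -
  \<comment> \<open>Nonnegativity follows from integrality in \<nat>; the total is given, and the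
    inequalities agree once \<open>theta\<close> is rewritten.\<close>
  have "\<alpha> \<in> {1..n} \<rightarrow>\<^sub>E {0..}"
    using assms(3) Nats_subset_Ints by (auto simp: PiE_iff Nats_def)
  then show ?thesis
    unfolding schubitope_def using assms(4) by (simp add: theta_eq_card_tableau[OF assms(2)])
qed

end
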